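(* Let $\epsilon\in(0,1)$, $C_a,C_b,C_c\in\mathbb{R}^2$ and $r_a,r_b,r_c\ge 0$. For an integer $m\ge 2$, a point $C\in\mathbb{R}^2$ and $r\ge 0$, let $$E^{2m}(C,r)=\left\{C+\frac{r}{\cos(\frac{\pi}{2m})}\begin{bmatrix}\cos\phi\\ \sin\phi\end{bmatrix}:\ \phi=\frac{(2k-1)\pi}{2m},\ k=1,2,\dots,2m\right\}\subset\mathbb{R}^2.$$ For $p\in\{a,b,c\}$ let $\mathcal{V}^p_{in}=\{x\in\mathbb{R}^2:\|x-C_p\|\le r_p\}$ and, for each $m\ge 2$, put $$\mathcal{E}^p=E^{2m}(C_p,r_p),\qquad \hat{\mathcal{E}}^p=E^{2m}\!\left(C_p,\,r_p\cos(\tfrac{\pi}{2m})\right).$$ With $J(V)=V^{\top}(A_n-\epsilon^2A_p)V$ for $V\in\mathbb{R}^6$, define $$F^*_b=\max_{V\in\partial\mathcal{V}^a_{in}\times\partial\mathcal{V}^b_{in}\times\partial\mathcal{V}^c_{in}}J(V),\quad F^*_e=\max_{V\in\mathcal{E}^a\times\mathcal{E}^b\times\mathcal{E}^c}J(V),\quad F^*_i=\max_{V\in\hat{\mathcal{E}}^a\times\hat{\mathcal{E}}^b\times\hat{\mathcal{E}}^c}J(V),$$ where $F^*_e$ and $F^*_i$ depend on $m$. Then for every $m\ge2$, $$|F^*_e-F^*_b|\le|F^*_e-F^*_i|,$$ and $$\lim_{m\to+\infty}|F^*_e-F^*_i|=0.$$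
   Context: $\|\cdot\|$ is the Euclidean norm, $\partial S$ is the boundary of a set $S\subset\mathbb{R}^2$, $\mathbb{I}_2$ is the $2\times2$ identity matrix, and angles in the following rotation matrices are in degrees. The real symmetric $6\times 6$ matrices $A_n$ and $A_p$ are $$A_n=\begin{bmatrix}\mathbb{I}_2 & B_n & B_n^{\top} \\ B_n^{\top} & \mathbb{I}_2 & B_n \\ B_n & B_n^{\top} & \mathbb{I}_2\end{bmatrix},\ B_n=\begin{bmatrix}\cos 240&-\sin 240\\ \sin 240&\cos 240\end{bmatrix},$$ $$A_p=\begin{bmatrix}\mathbb{I}_2 & B_p & B_p^{\top} \\ B_p^{\top} & \mathbb{I}_2 & B_p \\ B_p & B_p^{\top} & \mathbb{I}_2\end{bmatrix},\ B_p=\begin{bmatrix}\cos 120&-\sin 120\\ \sin 120&\cos 120\end{bmatrix}.$$ A Cartesian product of three subsets of $\mathbb{R}^2$ is regarded as a subset of $\mathbb{R}^6$ by concatenating vectors. $E^{2m}(C,r)$ is the vertex set of a regular $2m$-gon circumscribed about the disk with center $C$ and radius $r$. *)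

theory Defs
  imports "HOL-Analysis.Analysis"
begin

definition rot_deg :: "real \<Rightarrow> real^2^2" where
  "rot_deg \<theta> = vector [vector [cos (\<theta> * pi / 180), - sin (\<theta> * pi / 180)],
                      vector [sin (\<theta> * pi / 180),   cos (\<theta> * pi / 180)]]"

definition concat3 :: "real^2 \<Rightarrow> real^2 \<Rightarrow> real^2 \<Rightarrow> real^6" where
  "concat3 x y z = vector [x$1, x$2, y$1, y$2, z$1, z$2]"

definition prod3 :: "(real^2) set \<Rightarrow> (real^2) set \<Rightarrow> (real^2) set \<Rightarrow> (real^6) set" where
  "prod3 X Y Z = {concat3 x y z | x y z. x \<in> X \<and> y \<in> Y \<and> z \<in> Z}"

definition block3 ::
  "real^2^2 \<Rightarrow> real^2^2 \<Rightarrow> real^2^2 \<Rightarrow>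
   real^2^2 \<Rightarrow> real^2^2 \<Rightarrow> real^2^2 \<Rightarrow>
   real^2^2 \<Rightarrow> real^2^2 \<Rightarrow> real^2^2 \<Rightarrow> real^6^6" where
  "block3 P11 P12 P13 P21 P22 P23 P31 P32 P33 =
     vector [concat3 (P11$1) (P12$1) (P13$1),
             concat3 (P11$2) (P12$2) (P13$2),
             concat3 (P21$1) (P22$1) (P23$1),
             concat3 (P21$2) (P22$2) (P23$2),
             concat3 (P31$1) (P32$1) (P33$1),
             concat3 (P31$2) (P32$2) (P33$2)]"

definition B_n :: "real^2^2" where
  "B_n = rot_deg 240"

definition B_p :: "real^2^2" where
  "B_p = rot_deg 120"

definition A_n :: "real^6^6" where
  "A_n = block3 (mat 1)         B_n             (transpose B_n)
                (transpose B_n) (mat 1)         B_n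
                B_n             (transpose B_n) (mat 1)"

definition A_p :: "real^6^6" where
  "A_p = block3 (mat 1)         B_p             (transpose B_p)
                (transpose B_p) (mat 1)         B_p
                B_p             (transpose B_p) (mat 1)"

definition J :: "real \<Rightarrow> real^6 \<Rightarrow> real" where
  "J \<epsilon> V = V \<bullet> ((A_n - \<epsilon>\<^sup>2 *\<^sub>R A_p) *v V)"

definition V_in :: "real^2 \<Rightarrow> real \<Rightarrow> (real^2) set" where
  "V_in C r = {x. norm (x - C) \<le> r}"

text \<open>The first argument \<open>m\<close> is half the number of vertices.\<close>

definition E :: "nat \<Rightarrow> real^2 \<Rightarrow> real \<Rightarrow> (real^2) set" where
  "E m C r = {C + (r / cos (pi / (2 * real m))) *\<^sub>R vector [cos \<phi>, sin \<phi>] | \<phi> k.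
                k \<in> {1..2 * m} \<and> \<phi> = (2 * real k - 1) * pi / (2 * real m)}"

definition E_hat :: "nat \<Rightarrow> real^2 \<Rightarrow> real \<Rightarrow> (real^2) set" where
  "E_hat m C r = E m C (r * cos (pi / (2 * real m)))"

text \<open>The attained maximum, not merely a supremum: if no greatest value is attained, \<open>Greatest\<close>
  is unspecified.\<close>

definition max_on :: "('a \<Rightarrow> real) \<Rightarrow> 'a set \<Rightarrow> real" where
  "max_on f S = (GREATEST y. y \<in> f ` S)"

end

(*
  The diagonal blocks of A_n - eps^2 A_p are (1 - eps^2) I, so J is a convex quadratic in each of
  its three planar arguments separately.  Such a quadratic does not decrease when a point of the
  circle is replaced by the vertex of the circumscribed polygon lying closest to the direction of
  its gradient at the centre; replacing the arguments one at a time gives F_b <= F_e.  The inner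
  polygon is inscribed in the circle, so F_i <= F_b.  The two polygons have the same vertex
  directions and radii r / cos (pi / 2m) and r, so uniform continuity gives F_e - F_i -> 0.
*)

theory Submission
  imports Defs
begin

section \<open>Coordinates indexed by the six-element type\<close>

lemma exhaust_6:
  fixes x :: 6
  shows "x = 1 \<or> x = 2 \<or> x = 3 \<or> x = 4 \<or> x = 5 \<or> x = 6"
proof (induct x)
  case (of_int z)
  then have "0 \<le> z" and "z < 6" by simp_all
  then have "z = 0 \<or> z = 1 \<or> z = 2 \<or> z = 3 \<or> z = 4 \<or> z = 5" by arith
  then show ?case by auto
qed

lemma UNIV_6: "UNIV = {1::6, 2, 3, 4, 5, 6}"
  using exhaust_6 by auto

lemma sum_6: "sum f (UNIV::6 set) = f 1 + f 2 + f 3 + f 4 + f 5 + f 6"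
  unfolding UNIV_6 by (simp add: ac_simps)

lemma vector_6 [simp]:
  "(vector [a, b, c, d, e, f] :: 'a::zero^6) $ 1 = a"
  "(vector [a, b, c, d, e, f] :: 'a::zero^6) $ 2 = b"
  "(vector [a, b, c, d, e, f] :: 'a::zero^6) $ 3 = c"
  "(vector [a, b, c, d, e, f] :: 'a::zero^6) $ 4 = d"
  "(vector [a, b, c, d, e, f] :: 'a::zero^6) $ 5 = e"
  "(vector [a, b, c, d, e, f] :: 'a::zero^6) $ 6 = f"
  unfolding vector_def by simp_all

section \<open>The form \<open>J\<close> as a function of three planar arguments\<close>

lemma J_concat3:
  fixes x y z :: "real^2" and \<epsilon> :: real
  shows "J \<epsilon> (concat3 x y z) = (1 - \<epsilon>\<^sup>2) * (x \<bullet> x + y \<bullet> y + z \<bullet> z) +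
    2 * (x \<bullet> ((B_n - \<epsilon>\<^sup>2 *\<^sub>R B_p) *v y) + y \<bullet> ((B_n - \<epsilon>\<^sup>2 *\<^sub>R B_p) *v z) + z \<bullet> ((B_n - \<epsilon>\<^sup>2 *\<^sub>R B_p) *v x))"
  \<comment> \<open>An off-diagonal block and its transpose contribute the same bilinear term,
    whence the factor 2.\<close>
  unfolding J_def A_n_def A_p_def block3_def concat3_def
  by (simp add: inner_vec_def matrix_vector_mult_def sum_6 sum_2 transpose_def mat_def algebra_simps)

text \<open>This cyclic symmetry carries results about the first argument over to the other
  two.\<close>

lemma J_rotate: "J \<epsilon> (concat3 x y z) = J \<epsilon> (concat3 y z x)"
  by (simp add: J_concat3)

text \<open>Moving the matrix in the last bilinear term onto \<open>z\<close> makes both cross terms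
  inner products with \<open>x\<close>. Only this shape matters later, so \<open>w\<close> and
  \<open>d\<close>, which depend on \<open>y\<close> and \<open>z\<close>, stay abstract.\<close>

lemma J_quadratic_in_first:
  obtains w d where
    "\<And>x. J \<epsilon> (concat3 x y z) = (1 - \<epsilon>\<^sup>2) * (x \<bullet> x) + 2 * (x \<bullet> w) + d"
proof -
  define M where "M = B_n - \<epsilon>\<^sup>2 *\<^sub>R B_p"
  have "z \<bullet> (M *v x) = x \<bullet> (z v* M)" for x
    by (metis dot_lmul_matrix inner_commute)
  then have "J \<epsilon> (concat3 x y z) = (1 - \<epsilon>\<^sup>2) * (x \<bullet> x) + 2 * (x \<bullet> (M *v y + z v* M)) +
      ((1 - \<epsilon>\<^sup>2) * (y \<bullet> y + z \<bullet> z) + 2 * (y \<bullet> (M *v z)))" for x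
    unfolding J_concat3 M_def[symmetric]
    by (simp add: inner_add_right algebra_simps)
  then show ?thesis by (rule that)
qed

text \<open>Composed functions make this an introduction rule both for the projections of a triple
  and for the scaled polygon vertices in the limit argument.\<close>

lemma continuous_on_J_concat3 [continuous_intros]:
  assumes "continuous_on S f" "continuous_on S g" "continuous_on S h"
  shows "continuous_on S (\<lambda>p. J \<epsilon> (concat3 (f p) (g p) (h p)))"
  unfolding J_concat3
  by (intro continuous_intros assms
      matrix_vector_mult_linear_continuous_on[THEN continuous_on_compose2, OF _ subset_UNIV])

section \<open>Attained maxima over products of compact planar sets\<close>

lemma max_on_attained:
  assumes "compact X" "X \<noteq> {}" "compact Y" "Y \<noteq> {}" "compact Z" "Z \<noteq> {}"
  obtains x y z where "x \<in> X" "y \<in> Y" "z \<in> Z"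
    "max_on (J \<epsilon>) (prod3 X Y Z) = J \<epsilon> (concat3 x y z)"
    "\<And>x y z. x \<in> X \<Longrightarrow> y \<in> Y \<Longrightarrow> z \<in> Z \<Longrightarrow> J \<epsilon> (concat3 x y z) \<le> max_on (J \<epsilon>) (prod3 X Y Z)"
proof -
  \<comment> \<open>Passing to the product type gives compactness from that of the factors, without
    treating \<open>prod3\<close> as a subset of 6-space.\<close>
  define g where "g = (\<lambda>(x, y, z). J \<epsilon> (concat3 x y z))"
  have img: "J \<epsilon> ` prod3 X Y Z = g ` (X \<times> Y \<times> Z)"
    unfolding prod3_def g_def by (force simp: image_iff)
  have "compact (X \<times> Y \<times> Z)" "X \<times> Y \<times> Z \<noteq> {}"
    using assms by (auto intro: compact_Times)
  moreover have "continuous_on (X \<times> Y \<times> Z) g"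
    unfolding g_def case_prod_unfold by (intro continuous_intros)
  ultimately obtain p where p: "p \<in> X \<times> Y \<times> Z" "\<forall>q\<in>X \<times> Y \<times> Z. g q \<le> g p"
    using continuous_attains_sup by metis
  have m: "max_on (J \<epsilon>) (prod3 X Y Z) = g p"
    \<comment> \<open>\<open>GREATEST\<close> has a known value only once an attained upper bound is
      exhibited; \<open>p\<close> supplies it.\<close>
    unfolding max_on_def img by (rule Greatest_equality) (use p in auto)
  obtain x y z where "p = (x, y, z)" by (cases p)
  then show ?thesis
    using that[of x y z] p m by (auto simp: g_def)
qed

lemma J_le_max_on:
  assumes "compact X" "compact Y" "compact Z" "x \<in> X" "y \<in> Y" "z \<in> Z"
  shows "J \<epsilon> (concat3 x y z) \<le> max_on (J \<epsilon>) (prod3 X Y Z)"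
proof -
  have "X \<noteq> {}" "Y \<noteq> {}" "Z \<noteq> {}" using assms by auto
  then show ?thesis
    by (rule max_on_attained[OF assms(1) _ assms(2) _ assms(3)]) (use assms in blast)
qed

text \<open>This includes \<open>r = 0\<close>, where the disk is a single point and equals its own
  boundary.\<close>

lemma frontier_V_in: "frontier (V_in C r) = sphere C r"
proof -
  have "V_in C r = cball C r"
    by (auto simp: V_in_def dist_norm norm_minus_commute)
  then show ?thesis by simp
qed

section \<open>Polar coordinates in the plane\<close>

definition dir :: "real \<Rightarrow> real^2" where
  "dir \<phi> = vector [cos \<phi>, sin \<phi>]"

lemma dir_inner: "dir a \<bullet> dir b = cos (a - b)"
  by (simp add: dir_def inner_vec_def sum_2 cos_diff)

lemma norm_dir [simp]: "norm (dir a) = 1"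
  by (simp add: norm_eq_sqrt_inner dir_inner)

lemma polar_obtain:
  fixes w :: "real^2"
  obtains \<beta> where "0 \<le> \<beta>" "\<beta> < 2 * pi" "w = norm w *\<^sub>R dir \<beta>"
proof (cases "w = 0")
  case True
  then show ?thesis using that[of 0] by simp
next
  case False
  have "(w$1)\<^sup>2 + (w$2)\<^sup>2 = (norm w)\<^sup>2"
    unfolding power2_norm_eq_inner by (simp add: inner_vec_def sum_2 power2_eq_square)
  then have "(w$1 / norm w)\<^sup>2 + (w$2 / norm w)\<^sup>2 = 1"
    using False by (simp add: power_divide flip: add_divide_distrib)
  then obtain t where "0 \<le> t" "t < 2 * pi" "w$1 / norm w = cos t" "w$2 / norm w = sin t"
    by (rule sincos_total_2pi)
  then show ?thesis
    using that[of t] False by (simp add: vec_eq_iff forall_2 dir_def flip: \<open>_ = cos t\<close> \<open>_ = sin t\<close>)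
qed

text \<open>The circumradius factor \<open>1 / cos (pi / (2 * real m))\<close> thus lies in
  \<open>{1..2}\<close> for every \<open>m\<close> from 2 on, an interval independent of
  \<open>m\<close>.\<close>

lemma cos_half_step_bounds:
  assumes "2 \<le> m"
  shows "1/2 \<le> cos (pi / (2 * real m))" "cos (pi / (2 * real m)) \<le> 1"
proof -
  have "pi / (2 * real m) \<le> pi / 3"
    using assms by (intro divide_left_mono) auto
  then have "cos (pi / 3) \<le> cos (pi / (2 * real m))"
    by (intro cos_monotone_0_pi_le) auto
  then show "1/2 \<le> cos (pi / (2 * real m))" by (simp add: cos_60)
qed simp

section \<open>Polygon vertices, and convex quadratics evaluated at them\<close>

definition vertex_angles :: "nat \<Rightarrow> real set" where
  "vertex_angles m = (\<lambda>k. (2 * real k - 1) * pi / (2 * real m)) ` {1..2 * m}"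

lemma E_eq_image:
  "E m C r = (\<lambda>\<phi>. C + (r / cos (pi / (2 * real m))) *\<^sub>R dir \<phi>) ` vertex_angles m"
  unfolding E_def vertex_angles_def dir_def by blast

lemma E_hat_eq_image:
  assumes "2 \<le> m"
  shows "E_hat m C r = (\<lambda>\<phi>. C + r *\<^sub>R dir \<phi>) ` vertex_angles m"
  using cos_half_step_bounds(1)[OF assms] unfolding E_hat_def E_eq_image by simp

lemma compact_nonempty_E:
  assumes "2 \<le> m"
  shows "compact (E m C r)" "E m C r \<noteq> {}"
  using assms by (auto simp: E_eq_image vertex_angles_def intro: finite_imp_compact)

lemma E_hat_subset_sphere:
  assumes "2 \<le> m" "0 \<le> r"
  shows "E_hat m C r \<subseteq> sphere C r"
  using assms by (auto simp: E_hat_eq_image dist_norm)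

text \<open>The vertex angles are the midpoints of the \<open>2 * m\<close> arcs of length
  \<open>pi / m\<close> that partition the full turn, so every angle is within half an arc of one of
  them.\<close>

lemma vertex_angle_near:
  assumes "1 \<le> m" "0 \<le> \<beta>" "\<beta> < 2 * pi"
  obtains \<phi> where "\<phi> \<in> vertex_angles m" "\<bar>\<phi> - \<beta>\<bar> \<le> pi / (2 * real m)"
proof -
  \<comment> \<open>\<open>j\<close> numbers the arc containing \<open>\<beta>\<close> from 0,
    whereas vertices are numbered from 1; hence \<open>Suc j\<close> below.\<close>
  define j where "j = nat \<lfloor>\<beta> * real m / pi\<rfloor>"
  have "0 \<le> \<beta> * real m / pi" using assms by simp
  then have j: "real j \<le> \<beta> * real m / pi" "\<beta> * real m / pi < real j + 1"
    unfolding j_def by linarith+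
  have "\<beta> * real m / pi < 2 * real m"
    using assms by (simp add: field_simps)
  with j(1) have "real j < real (2 * m)" by simp
  then have "Suc j \<in> {1..2 * m}" by simp
  moreover have "\<bar>(2 * real (Suc j) - 1) * pi / (2 * real m) - \<beta>\<bar> \<le> pi / (2 * real m)"
  proof -
    have "real j * pi \<le> \<beta> * real m" "\<beta> * real m \<le> (real j + 1) * pi"
      using j by (simp_all add: field_simps)
    then show ?thesis
      using assms(1) by (simp add: abs_le_iff field_simps)
  qed
  ultimately show ?thesis using that unfolding vertex_angles_def by blast
qed

text \<open>The vertex nearest in angle to \<open>w\<close> loses at most the factor
  \<open>?c\<close> in the inner product, and the circumradius \<open>r / ?c\<close> makes up for
  it. Both bounds are needed at the same vertex: one for the linear and one for the square term of a
  quadratic.\<close>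

lemma E_support:
  assumes "2 \<le> m" "0 \<le> r"
  obtains e where "e \<in> E m C r" "r * norm w \<le> (e - C) \<bullet> w" "r \<le> norm (e - C)"
proof -
  let ?c = "cos (pi / (2 * real m))"
  note c = cos_half_step_bounds[OF assms(1)]
  obtain \<beta> where \<beta>: "0 \<le> \<beta>" "\<beta> < 2 * pi" "w = norm w *\<^sub>R dir \<beta>"
    by (rule polar_obtain)
  obtain \<phi> where \<phi>: "\<phi> \<in> vertex_angles m" "\<bar>\<phi> - \<beta>\<bar> \<le> pi / (2 * real m)"
    using vertex_angle_near[of m \<beta>] \<beta> assms by auto
  \<comment> \<open>Cosine is monotone on the interval from 0 to \<open>pi\<close>, hence this bound
    and the absolute value in the next step.\<close>
  have "pi / (2 * real m) \<le> pi"
    using assms by (simp add: divide_le_eq)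
  then have "?c \<le> cos \<bar>\<phi> - \<beta>\<bar>"
    using \<phi>(2) by (intro cos_monotone_0_pi_le) auto
  then have cc: "?c \<le> cos (\<phi> - \<beta>)" by simp
  define e where "e = C + (r / ?c) *\<^sub>R dir \<phi>"
  have "r \<le> r / ?c"
    using c assms(2) by (simp add: field_simps mult_left_le)
  then have "r \<le> norm (e - C)"
    using c assms(2) by (simp add: e_def)
  moreover have "r * norm w \<le> (e - C) \<bullet> w"
  proof -
    have "(e - C) \<bullet> w = (r / ?c) * norm w * cos (\<phi> - \<beta>)"
      \<comment> \<open>The equation has \<open>w\<close> on both sides and would loop as a
        simplification rule.\<close>
      by (subst \<beta>(3)) (simp add: e_def dir_inner)
    moreover have "(r / ?c) * norm w * ?c \<le> (r / ?c) * norm w * cos (\<phi> - \<beta>)"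
      using cc c assms(2) by (intro mult_left_mono) auto
    moreover have "(r / ?c) * norm w * ?c = r * norm w"
      using c by simp
    ultimately show ?thesis by simp
  qed
  moreover have "e \<in> E m C r"
    using \<phi>(1) by (auto simp: E_eq_image e_def)
  ultimately show ?thesis using that by blast
qed

text \<open>Expanded about \<open>C\<close>, the quadratic is a square term, a linear term and a
  constant. On the circle the square term is fixed and Cauchy-Schwarz bounds the linear one; the
  vertex from \<open>E_support\<close> does at least as well in each, with \<open>0 \<le> a\<close>
  used for the square.\<close>

lemma quadratic_le_at_vertex:
  assumes "2 \<le> m" "0 \<le> r" "0 \<le> a" "x \<in> sphere C r"
  obtains e where "e \<in> E m C r" "a * (x \<bullet> x) + 2 * (x \<bullet> w) \<le> a * (e \<bullet> e) + 2 * (e \<bullet> w)"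
proof -
  \<comment> \<open>Half the gradient at \<open>C\<close>.\<close>
  define g where "g = a *\<^sub>R C + w"
  have expand: "a * (v \<bullet> v) + 2 * (v \<bullet> w) =
      a * (norm (v - C))\<^sup>2 + 2 * ((v - C) \<bullet> g) + (a * (C \<bullet> C) + 2 * (C \<bullet> w))" for v
    unfolding g_def power2_norm_eq_inner
    by (simp add: inner_diff_left inner_diff_right inner_add_right inner_commute algebra_simps)
  obtain e where e: "e \<in> E m C r" "r * norm g \<le> (e - C) \<bullet> g" "r \<le> norm (e - C)"
    using E_support[OF assms(1,2)] by blast
  have x: "norm (x - C) = r"
    using assms(4) by (simp add: dist_norm norm_minus_commute)
  have "(x - C) \<bullet> g \<le> r * norm g"
    using norm_cauchy_schwarz[of "x - C" g] x by simp
  moreover have "a * (norm (x - C))\<^sup>2 \<le> a * (norm (e - C))\<^sup>2"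
    using x e(3) assms by (intro mult_left_mono power_mono) auto
  ultimately show ?thesis
    using that[OF e(1)] e(2) expand[of x] expand[of e] by linarith
qed

section \<open>Moving points of the circles to vertices\<close>

lemma J_le_at_vertex:
  assumes "2 \<le> m" "0 \<le> r" "\<epsilon>\<^sup>2 \<le> 1" "x \<in> sphere C r"
  obtains e where "e \<in> E m C r" "J \<epsilon> (concat3 x y z) \<le> J \<epsilon> (concat3 e y z)"
proof -
  obtain w d where J: "\<And>x. J \<epsilon> (concat3 x y z) = (1 - \<epsilon>\<^sup>2) * (x \<bullet> x) + 2 * (x \<bullet> w) + d"
    using J_quadratic_in_first by blast
  obtain e where "e \<in> E m C r"
    "(1 - \<epsilon>\<^sup>2) * (x \<bullet> x) + 2 * (x \<bullet> w) \<le> (1 - \<epsilon>\<^sup>2) * (e \<bullet> e) + 2 * (e \<bullet> w)"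
    using quadratic_le_at_vertex[OF assms(1,2) _ assms(4), of "1 - \<epsilon>\<^sup>2" w] assms(3) by auto
  then show ?thesis using that unfolding J by simp
qed

lemma J_le_at_vertices:
  assumes "2 \<le> m" "0 \<le> r\<^sub>a" "0 \<le> r\<^sub>b" "0 \<le> r\<^sub>c" "\<epsilon>\<^sup>2 \<le> 1"
    and "x \<in> sphere C\<^sub>a r\<^sub>a" "y \<in> sphere C\<^sub>b r\<^sub>b" "z \<in> sphere C\<^sub>c r\<^sub>c"
  obtains x' y' z' where "x' \<in> E m C\<^sub>a r\<^sub>a" "y' \<in> E m C\<^sub>b r\<^sub>b" "z' \<in> E m C\<^sub>c r\<^sub>c"
    "J \<epsilon> (concat3 x y z) \<le> J \<epsilon> (concat3 x' y' z')"
proof -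
  obtain x' where x': "x' \<in> E m C\<^sub>a r\<^sub>a" "J \<epsilon> (concat3 x y z) \<le> J \<epsilon> (concat3 x' y z)"
    using J_le_at_vertex[OF assms(1,2,5,6)] by blast
  \<comment> \<open>The triple is rotated to bring the next circle point to the front; the new
    vertex \<open>x'\<close> is now a fixed argument.\<close>
  obtain y' where y': "y' \<in> E m C\<^sub>b r\<^sub>b" "J \<epsilon> (concat3 y z x') \<le> J \<epsilon> (concat3 y' z x')"
    using J_le_at_vertex[OF assms(1,3,5,7)] by blast
  obtain z' where z': "z' \<in> E m C\<^sub>c r\<^sub>c" "J \<epsilon> (concat3 z x' y') \<le> J \<epsilon> (concat3 z' x' y')"
    using J_le_at_vertex[OF assms(1,4,5,8)] by blast
  note x'(2)
  also have "J \<epsilon> (concat3 x' y z) = J \<epsilon> (concat3 y z x')" by (rule J_rotate)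
  also note y'(2)
  also have "J \<epsilon> (concat3 y' z x') = J \<epsilon> (concat3 z x' y')" by (rule J_rotate)
  also note z'(2)
  also have "J \<epsilon> (concat3 z' x' y') = J \<epsilon> (concat3 x' y' z')" by (rule J_rotate)
  finally show ?thesis using that x' y' z' by blast
qed

section \<open>Comparison of the three maxima, and the limit\<close>

lemma max_E_hat_le_max_sphere:
  assumes "2 \<le> m" "0 \<le> r\<^sub>a" "0 \<le> r\<^sub>b" "0 \<le> r\<^sub>c"
  shows "max_on (J \<epsilon>) (prod3 (E_hat m C\<^sub>a r\<^sub>a) (E_hat m C\<^sub>b r\<^sub>b) (E_hat m C\<^sub>c r\<^sub>c))
    \<le> max_on (J \<epsilon>) (prod3 (sphere C\<^sub>a r\<^sub>a) (sphere C\<^sub>b r\<^sub>b) (sphere C\<^sub>c r\<^sub>c))"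
proof -
  obtain x y z where "x \<in> E_hat m C\<^sub>a r\<^sub>a" "y \<in> E_hat m C\<^sub>b r\<^sub>b" "z \<in> E_hat m C\<^sub>c r\<^sub>c"
    and eq: "max_on (J \<epsilon>) (prod3 (E_hat m C\<^sub>a r\<^sub>a) (E_hat m C\<^sub>b r\<^sub>b) (E_hat m C\<^sub>c r\<^sub>c))
      = J \<epsilon> (concat3 x y z)"
    unfolding E_hat_def
    by (rule max_on_attained[OF compact_nonempty_E[OF assms(1)] compact_nonempty_E[OF assms(1)]
          compact_nonempty_E[OF assms(1)]]) blast
  then have "x \<in> sphere C\<^sub>a r\<^sub>a" "y \<in> sphere C\<^sub>b r\<^sub>b" "z \<in> sphere C\<^sub>c r\<^sub>c"
    using E_hat_subset_sphere assms by blast+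
  then show ?thesis
    unfolding eq by (intro J_le_max_on compact_sphere)
qed

lemma max_sphere_le_max_E:
  assumes "2 \<le> m" "0 \<le> r\<^sub>a" "0 \<le> r\<^sub>b" "0 \<le> r\<^sub>c" "\<epsilon>\<^sup>2 \<le> 1"
  shows "max_on (J \<epsilon>) (prod3 (sphere C\<^sub>a r\<^sub>a) (sphere C\<^sub>b r\<^sub>b) (sphere C\<^sub>c r\<^sub>c))
    \<le> max_on (J \<epsilon>) (prod3 (E m C\<^sub>a r\<^sub>a) (E m C\<^sub>b r\<^sub>b) (E m C\<^sub>c r\<^sub>c))"
proof -
  have ne: "sphere C r \<noteq> {}" if "0 \<le> r" for C :: "real^2" and r
    using that by simp
  obtain x y z where xyz: "x \<in> sphere C\<^sub>a r\<^sub>a" "y \<in> sphere C\<^sub>b r\<^sub>b" "z \<in> sphere C\<^sub>c r\<^sub>c"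
    and eq: "max_on (J \<epsilon>) (prod3 (sphere C\<^sub>a r\<^sub>a) (sphere C\<^sub>b r\<^sub>b) (sphere C\<^sub>c r\<^sub>c))
      = J \<epsilon> (concat3 x y z)"
    by (rule max_on_attained[OF compact_sphere ne[OF assms(2)] compact_sphere ne[OF assms(3)]
          compact_sphere ne[OF assms(4)]]) blast
  obtain x' y' z' where v: "x' \<in> E m C\<^sub>a r\<^sub>a" "y' \<in> E m C\<^sub>b r\<^sub>b" "z' \<in> E m C\<^sub>c r\<^sub>c"
    and "J \<epsilon> (concat3 x y z) \<le> J \<epsilon> (concat3 x' y' z')"
    using J_le_at_vertices[OF assms xyz] by blast
  note this(4)
  also have "J \<epsilon> (concat3 x' y' z') \<le> max_on (J \<epsilon>) (prod3 (E m C\<^sub>a r\<^sub>a) (E m C\<^sub>b r\<^sub>b) (E m C\<^sub>c r\<^sub>c))"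
    using v by (intro J_le_max_on compact_nonempty_E assms)
  finally show ?thesis
    unfolding eq .
qed

text \<open>A one-sided estimate suffices, since the comparison through the circles gives the
  opposite inequality.\<close>

lemma max_E_minus_max_E_hat_small:
  assumes "0 < \<eta>"
  shows "\<forall>\<^sub>F m in sequentially.
    max_on (J \<epsilon>) (prod3 (E m C\<^sub>a r\<^sub>a) (E m C\<^sub>b r\<^sub>b) (E m C\<^sub>c r\<^sub>c))
    < max_on (J \<epsilon>) (prod3 (E_hat m C\<^sub>a r\<^sub>a) (E_hat m C\<^sub>b r\<^sub>b) (E_hat m C\<^sub>c r\<^sub>c)) + \<eta>"
proof -
  \<comment> \<open>\<open>s\<close> is the common scale: \<open>1 / cos (pi / (2 * real m))\<close>
    gives the outer polygons and 1 the inner ones. The maximizing directions vary with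
    \<open>m\<close>, so continuity must be uniform over a compact set of scales and
    directions.\<close>
  define h where "h = (\<lambda>(s, u, v, w). J \<epsilon> (concat3 (C\<^sub>a + (s * r\<^sub>a) *\<^sub>R u) (C\<^sub>b + (s * r\<^sub>b) *\<^sub>R v) (C\<^sub>c + (s * r\<^sub>c) *\<^sub>R w)))"
  let ?U = "sphere 0 1 :: (real^2) set"
  let ?K = "{1..2::real} \<times> ?U \<times> ?U \<times> ?U"
  have "compact ?K"
    by (intro compact_Times compact_sphere compact_Icc)
  moreover have "continuous_on ?K h"
    unfolding h_def case_prod_unfold by (intro continuous_intros)
  ultimately have "uniformly_continuous_on ?K h"
    by (rule compact_uniformly_continuous[rotated])
  then obtain \<delta> where \<delta>: "0 < \<delta>"
    "\<And>p q. p \<in> ?K \<Longrightarrow> q \<in> ?K \<Longrightarrow> dist q p < \<delta> \<Longrightarrow> dist (h q) (h p) < \<eta>"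
    using assms unfolding uniformly_continuous_on_def by meson
  have "(\<lambda>m. pi / (2 * real m)) \<longlonglongrightarrow> 0"
    by (rule real_tendsto_divide_at_top[OF tendsto_const]) (intro filterlim_tendsto_pos_mult_at_top[OF tendsto_const] filterlim_real_sequentially; simp)
  then have "(\<lambda>m. 1 / cos (pi / (2 * real m))) \<longlonglongrightarrow> 1 / cos 0"
    by (intro tendsto_intros) auto
  then have "\<forall>\<^sub>F m in sequentially. dist (1 / cos (pi / (2 * real m))) 1 < \<delta>"
    using \<delta>(1) by (simp add: tendsto_iff)
  then show ?thesis
    using eventually_ge_at_top[of 2]
  proof eventually_elim
    case (elim m)
    let ?s = "1 / cos (pi / (2 * real m))"
    have s: "?s \<in> {1..2}"
      using cos_half_step_bounds[OF elim(2)] by (simp add: field_simps)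
    obtain x y z where "x \<in> E m C\<^sub>a r\<^sub>a" "y \<in> E m C\<^sub>b r\<^sub>b" "z \<in> E m C\<^sub>c r\<^sub>c"
      and eq: "max_on (J \<epsilon>) (prod3 (E m C\<^sub>a r\<^sub>a) (E m C\<^sub>b r\<^sub>b) (E m C\<^sub>c r\<^sub>c)) = J \<epsilon> (concat3 x y z)"
      by (rule max_on_attained[OF compact_nonempty_E[OF elim(2)] compact_nonempty_E[OF elim(2)]
            compact_nonempty_E[OF elim(2)]]) blast
    then obtain \<alpha> \<beta> \<gamma> where angles:
      "\<alpha> \<in> vertex_angles m" "\<beta> \<in> vertex_angles m" "\<gamma> \<in> vertex_angles m"
      and "x = C\<^sub>a + (?s * r\<^sub>a) *\<^sub>R dir \<alpha>" "y = C\<^sub>b + (?s * r\<^sub>b) *\<^sub>R dir \<beta>" "z = C\<^sub>c + (?s * r\<^sub>c) *\<^sub>R dir \<gamma>"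
      by (auto simp: E_eq_image)
    then have e: "J \<epsilon> (concat3 x y z) = h (?s, dir \<alpha>, dir \<beta>, dir \<gamma>)"
      by (simp add: h_def)
    \<comment> \<open>Keeping the angles of the outer maximizer and setting the scale to 1 gives a
      competitor for the inner maximum.\<close>
    have "h (1, dir \<alpha>, dir \<beta>, dir \<gamma>)
        \<le> max_on (J \<epsilon>) (prod3 (E_hat m C\<^sub>a r\<^sub>a) (E_hat m C\<^sub>b r\<^sub>b) (E_hat m C\<^sub>c r\<^sub>c))"
      unfolding h_def prod.case mult_1
    proof (rule J_le_max_on)
      show "compact (E_hat m C\<^sub>a r\<^sub>a)" "compact (E_hat m C\<^sub>b r\<^sub>b)" "compact (E_hat m C\<^sub>c r\<^sub>c)"
        unfolding E_hat_def using compact_nonempty_E[OF elim(2)] by blast+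
    qed (use angles E_hat_eq_image[OF elim(2)] in auto)
    \<comment> \<open>The two arguments differ only in the scale, so their distance is that of
      \<open>?s\<close> from 1.\<close>
    moreover have "dist (h (?s, dir \<alpha>, dir \<beta>, dir \<gamma>)) (h (1, dir \<alpha>, dir \<beta>, dir \<gamma>)) < \<eta>"
      using s elim(1) by (intro \<delta>(2)) (auto simp: dist_Pair_Pair)
    ultimately show ?case
      unfolding eq e dist_real_def by linarith
  qed
qed

theorem mainTheorem1:
  fixes \<epsilon> r\<^sub>a r\<^sub>b r\<^sub>c F\<^sub>b :: real and C\<^sub>a C\<^sub>b C\<^sub>c :: "real^2" and F\<^sub>e F\<^sub>i :: "nat \<Rightarrow> real"
  assumes "0 < \<epsilon>" and "\<epsilon> < 1"
    and "0 \<le> r\<^sub>a" and "0 \<le> r\<^sub>b" and "0 \<le> r\<^sub>c"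
    and "F\<^sub>b = max_on (J \<epsilon>) (prod3 (frontier (V_in C\<^sub>a r\<^sub>a)) (frontier (V_in C\<^sub>b r\<^sub>b)) (frontier (V_in C\<^sub>c r\<^sub>c)))"
    and "\<And>m. m \<ge> 2 \<Longrightarrow> F\<^sub>e m = max_on (J \<epsilon>) (prod3 (E m C\<^sub>a r\<^sub>a) (E m C\<^sub>b r\<^sub>b) (E m C\<^sub>c r\<^sub>c))"
    and "\<And>m. m \<ge> 2 \<Longrightarrow> F\<^sub>i m = max_on (J \<epsilon>) (prod3 (E_hat m C\<^sub>a r\<^sub>a) (E_hat m C\<^sub>b r\<^sub>b) (E_hat m C\<^sub>c r\<^sub>c))"
  shows "(\<forall>m\<ge>2. \<bar>F\<^sub>e m - F\<^sub>b\<bar> \<le> \<bar>F\<^sub>e m - F\<^sub>i m\<bar>) \<and> (\<lambda>m. \<bar>F\<^sub>e m - F\<^sub>i m\<bar>) \<longlonglongrightarrow> 0"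
proof -
  have "\<epsilon>\<^sup>2 \<le> 1"
    using assms(1,2) by (simp add: power_le_one)
  \<comment> \<open>This chain removes the absolute values: \<open>F\<^sub>b\<close> lies between
    \<open>F\<^sub>i m\<close> and \<open>F\<^sub>e m\<close>, which also yields the first
    claim.\<close>
  then have *: "F\<^sub>i m \<le> F\<^sub>b" "F\<^sub>b \<le> F\<^sub>e m" if "2 \<le> m" for m
    using that assms(3-8) max_E_hat_le_max_sphere max_sphere_le_max_E
    by (simp_all add: frontier_V_in)
  have "\<forall>\<^sub>F m in sequentially. \<bar>F\<^sub>e m - F\<^sub>i m\<bar> < \<eta>" if "0 < \<eta>" for \<eta>
    \<comment> \<open>The sequences are specified only from \<open>m = 2\<close> on, hence the
      second eventuality.\<close>
    using max_E_minus_max_E_hat_small[OF that, of \<epsilon> C\<^sub>a r\<^sub>a C\<^sub>b r\<^sub>b C\<^sub>c r\<^sub>c] eventually_ge_at_top[of 2]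
  proof eventually_elim
    case (elim m)
    then show ?case
      using *[of m] assms(7,8)[of m] by simp
  qed
  then have "(\<lambda>m. \<bar>F\<^sub>e m - F\<^sub>i m\<bar>) \<longlonglongrightarrow> 0"
    by (simp add: tendsto_iff)
  moreover have "\<bar>F\<^sub>e m - F\<^sub>b\<bar> \<le> \<bar>F\<^sub>e m - F\<^sub>i m\<bar>" if "2 \<le> m" for m
    using *[OF that] by simp
  ultimately show ?thesis by blast
qed

end
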